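(* Let $n \in \mathbb{N}$ and let $\mathbb{K}$ be a non-Archimedean valued field with valuation $|\cdot|$. Let $(a_j)_{j=1}^n, (b_j)_{j=1}^n \in \mathbb{K}^n$. Then $$\left|\sum_{j=1}^{n}a_j\right|\left|\sum_{k=1}^{n}b_k\right|\leq \max\left\{|n|\left|\sum_{j=1}^{n}a_jb_j\right|,\ \max_{1\leq j < k \leq n}|a_j-a_k||b_j-b_k|\right\}.$$ In other words, $$\left|AM(a_j)_{j=1}^n\right|\left|AM(b_j)_{j=1}^n\right|\leq \max\left\{\left|AM(a_jb_j)_{j=1}^n\right|,\ \frac{1}{|n|^2}\max_{1\leq j < k \leq n}|a_j-a_k||b_j-b_k|\right\}.$$
   Context: A non-Archimedean valued field is a field $\mathbb{K}$ with a map (non-Archimedean valuation) $|\cdot|:\mathbb{K}\to[0,\infty)$ such that (i) if $\lambda\in\mathbb{K}$ is such that $|\lambda|=0$, then $\lambda=0$; (ii) $|\lambda\mu|=|\lambda||\mu|$ for all $\lambda,\mu\in\mathbb{K}$; (iii) $|\lambda+\mu|\leq\max\{|\lambda|,|\mu|\}$ for all $\lambda,\mu\in\mathbb{K}$. Here $|n|$ denotes the valuation of $n$ regarded as the element $n\cdot 1_{\mathbb{K}}$ of $\mathbb{K}$. $AM$ denotes the arithmetic mean: $AM(c_j)_{j=1}^n:=\frac{\sum_{j=1}^n c_j}{n}$. *)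

theory Defs
  imports Complex_Main
begin

text \<open>The axioms do not include \<open>val 0 = 0\<close>; the only map satisfying them but violating
  it is the constant function 1.\<close>

locale nonarchimedean_valuation =
  fixes val :: "'k::field \<Rightarrow> real"
  assumes val_nonneg: "0 \<le> val x"
    and val_eq_0: "val x = 0 \<Longrightarrow> x = 0"
    and val_mult: "val (x * y) = val x * val y"
    and val_ultrametric: "val (x + y) \<le> max (val x) (val y)"

text \<open>The mean is taken in the field, so it is meaningful only if \<open>of_nat n \<noteq> 0\<close> there.\<close>

definition AM :: "nat \<Rightarrow> (nat \<Rightarrow> 'k::field) \<Rightarrow> 'k" where
  "AM n c = (\<Sum>j=1..n. c j) / of_nat n"

text \<open>Inserting 0 makes the maximum over the empty set of pairs (\<open>n = 1\<close>) equal to 0; it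
  does not affect \<open>n \<ge> 2\<close>, as all the products are nonnegative for a valuation.\<close>

definition max_pair_diff :: "('k::field \<Rightarrow> real) \<Rightarrow> nat \<Rightarrow> (nat \<Rightarrow> 'k) \<Rightarrow> (nat \<Rightarrow> 'k) \<Rightarrow> real" where
  "max_pair_diff val n a b =
     Max (insert 0 {val (a j - a k) * val (b j - b k) | j k. 1 \<le> j \<and> j < k \<and> k \<le> n})"

end

theory Submission
  imports Defs
begin

text \<open>
  The proof rests on the Lagrange-type identity
  \<open>n (\<Sum>j. a j * b j) - (\<Sum>j. a j) (\<Sum>k. b k) = (\<Sum>j<k. (a j - a k) * (b j - b k))\<close>,
  which holds in every commutative ring and is proved in \<open>sum_product_pair_differences\<close>.
  It writes the product of the two sums as a difference of two terms. The ultrametric inequality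
  bounds the valuation of this difference by the larger of the two valuations, and bounds the
  valuation of the sum over pairs by its largest summand (\<open>val_sum_le\<close>). The inequality
  between the means is the first inequality divided by \<open>(val n)\<^sup>2\<close>.

  The only complication is a map with \<open>val 0 \<noteq> 0\<close>. Multiplicativity forces such a map to be
  constantly 1, and then the first inequality is trivial.
\<close>

text \<open>The sum runs over \<open>j < k\<close> only. Summing over all ordered pairs would give twice the
  identity, which is void in characteristic 2; this is why the proof proceeds by induction instead
  of by exchanging the two summations.\<close>

lemma sum_product_pair_differences:
  fixes a b :: "nat \<Rightarrow> 'a::comm_ring_1"
  shows "(\<Sum>j=1..n. a j) * (\<Sum>k=1..n. b k)
    = of_nat n * (\<Sum>j=1..n. a j * b j)
      - (\<Sum>k=1..n. \<Sum>j=1..<k. (a j - a k) * (b j - b k))"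
proof (induction n)
  case 0
  show ?case by simp
next
  case (Suc n)
  let ?x = "a (Suc n)" and ?y = "b (Suc n)"
  define d where "d k = (\<Sum>j=1..<k. (a j - a k) * (b j - b k))" for k
  have "d (Suc n) = (\<Sum>j=1..n. a j * b j - a j * ?y - ?x * b j + ?x * ?y)"
    unfolding d_def by (intro sum.cong) (auto simp: algebra_simps)
  also have "\<dots> = (\<Sum>j=1..n. a j * b j) - (\<Sum>j=1..n. a j) * ?y - ?x * (\<Sum>j=1..n. b j)
      + of_nat n * (?x * ?y)"
    by (simp add: sum.distrib sum_subtractf sum_distrib_left sum_distrib_right)
  finally have row: "d (Suc n) = \<dots>" .
  have "of_nat n * (\<Sum>j=1..n. a j * b j)
      = (\<Sum>j=1..n. a j) * (\<Sum>k=1..n. b k) + (\<Sum>k=1..n. d k)"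
    using Suc.IH unfolding d_def[symmetric] by simp
  with row show ?case
    unfolding d_def[symmetric] by (simp add: algebra_simps)
qed

context nonarchimedean_valuation
begin

lemma val_1: "val 1 = 1"
proof -
  have "val 1 \<noteq> 0" using val_eq_0[of 1] by auto
  thus ?thesis using val_mult[of 1 1] by simp
qed

lemma val_minus: "val (- x) = val x"
proof -
  have "val (-1) * val (-1) = 1" using val_mult[of "-1" "-1"] val_1 by simp
  hence "val (-1) = 1"
    using val_nonneg[of "-1"] by (metis abs_of_nonneg abs_square_eq_1 power2_eq_square)
  thus ?thesis using val_mult[of "-1" x] by simp
qed

lemma val_diff_le: "val (x - y) \<le> max (val x) (val y)"
  using val_ultrametric[of x "- y"] by (simp add: val_minus)

lemma val_divide: "y \<noteq> 0 \<Longrightarrow> val (x / y) = val x / val y"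
  using val_mult[of "x / y" y] val_eq_0[of y] by (auto simp: field_simps)

text \<open>Since \<open>0 = 0 * x\<close>, a nonzero value at 0 can be cancelled from \<open>val 0 = val 0 * val x\<close>.\<close>

lemma val_const_1:
  assumes "val 0 \<noteq> 0"
  shows "val x = 1"
  using val_mult[of 0 x] assms by simp

text \<open>The bound \<open>val 0 \<le> M\<close> covers the sums that are 0 because \<open>A\<close> is empty or infinite.\<close>

lemma val_sum_le:
  assumes "val 0 \<le> M" and "\<And>i. i \<in> A \<Longrightarrow> val (f i) \<le> M"
  shows "val (sum f A) \<le> M"
  using assms(2)
proof (induction A rule: infinite_finite_induct)
  case (insert x A)
  have "val (f x + sum f A) \<le> max (val (f x)) (val (sum f A))" by (rule val_ultrametric)
  also have "\<dots> \<le> M" using insert by simp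
  finally show ?case using insert by simp
qed (use assms(1) in auto)

lemma max_pair_diff_upper:
  shows "0 \<le> max_pair_diff val n a b"
    and "1 \<le> j \<Longrightarrow> j < k \<Longrightarrow> k \<le> n
           \<Longrightarrow> val (a j - a k) * val (b j - b k) \<le> max_pair_diff val n a b"
proof -
  let ?S = "{val (a j - a k) * val (b j - b k) | j k. 1 \<le> j \<and> j < k \<and> k \<le> n}"
  have "?S \<subseteq> (\<lambda>(j, k). val (a j - a k) * val (b j - b k)) ` ({1..n} \<times> {1..n})"
    by force
  hence fin: "finite (insert 0 ?S)"
    by (meson finite_SigmaI finite_atLeastAtMost finite_imageI finite_insert finite_subset)
  show "0 \<le> max_pair_diff val n a b"
    unfolding max_pair_diff_def by (rule Max_ge[OF fin]) simp
  show "val (a j - a k) * val (b j - b k) \<le> max_pair_diff val n a b"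
    if "1 \<le> j" "j < k" "k \<le> n"
    unfolding max_pair_diff_def by (rule Max_ge[OF fin]) (use that in blast)
qed

lemma val_sum_mult_val_sum_le:
  "val (\<Sum>j=1..n. a j) * val (\<Sum>k=1..n. b k)
    \<le> max (val (of_nat n) * val (\<Sum>j=1..n. a j * b j)) (max_pair_diff val n a b)"
proof (cases "val 0 = 0")
  case True
  let ?D = "\<Sum>k=1..n. \<Sum>j=1..<k. (a j - a k) * (b j - b k)"
  have D: "val ?D \<le> max_pair_diff val n a b"
    by (intro val_sum_le) (auto simp: True val_mult intro!: max_pair_diff_upper)
  have "val (\<Sum>j=1..n. a j) * val (\<Sum>k=1..n. b k)
      = val (of_nat n * (\<Sum>j=1..n. a j * b j) - ?D)"
    by (simp only: sum_product_pair_differences flip: val_mult)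
  also have "\<dots> \<le> max (val (of_nat n) * val (\<Sum>j=1..n. a j * b j)) (val ?D)"
    by (metis val_diff_le val_mult)
  finally show ?thesis using D by linarith
next
  case False
  then show ?thesis by (simp add: val_const_1)
qed

lemma val_AM_mult_val_AM_le:
  assumes "of_nat n \<noteq> (0::'k)"
  shows "val (AM n a) * val (AM n b)
    \<le> max (val (AM n (\<lambda>j. a j * b j))) (1 / (val (of_nat n))\<^sup>2 * max_pair_diff val n a b)"
proof -
  let ?v = "val (of_nat n)"
  have v: "?v > 0" using val_nonneg[of "of_nat n"] val_eq_0[of "of_nat n"] assms by fastforce
  have "val (AM n a) * val (AM n b)
      = val (\<Sum>j=1..n. a j) * val (\<Sum>k=1..n. b k) / ?v\<^sup>2"
    by (simp add: AM_def val_divide assms power2_eq_square)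
  also have "\<dots> \<le> max (?v * val (\<Sum>j=1..n. a j * b j)) (max_pair_diff val n a b) / ?v\<^sup>2"
    by (intro divide_right_mono val_sum_mult_val_sum_le) simp
  also have "\<dots> = max (?v * val (\<Sum>j=1..n. a j * b j) / ?v\<^sup>2) (max_pair_diff val n a b / ?v\<^sup>2)"
    by (simp add: max_divide_distrib_right)
  also have "?v * val (\<Sum>j=1..n. a j * b j) / ?v\<^sup>2 = val (AM n (\<lambda>j. a j * b j))"
    using v by (simp add: AM_def val_divide assms power2_eq_square)
  finally show ?thesis by simp
qed

end

theorem theorem2p5:
  fixes val :: "'k::field \<Rightarrow> real"
    and n :: nat
    and a b :: "nat \<Rightarrow> 'k"
  assumes "nonarchimedean_valuation val"
    and "n \<ge> 1"
  shows "val (\<Sum>j=1..n. a j) * val (\<Sum>k=1..n. b k)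
           \<le> max (val (of_nat n) * val (\<Sum>j=1..n. a j * b j)) (max_pair_diff val n a b)
         \<and> (of_nat n \<noteq> (0::'k) \<longrightarrow>
             val (AM n a) * val (AM n b)
               \<le> max (val (AM n (\<lambda>j. a j * b j)))
                     (1 / (val (of_nat n))\<^sup>2 * max_pair_diff val n a b))"
proof -
  interpret nonarchimedean_valuation val by fact
  show ?thesis using val_sum_mult_val_sum_le val_AM_mult_val_AM_le by blast
qed

end
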